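(* Let $\alpha>1$ and $\beta\in\mathbb{R}$. Then for all $s\in\mathbb{C}\setminus\{0\}$, $$\mathcal{L}\left(\frac{\partial}{\partial\alpha}\left[E_{\alpha,\beta}(t)\right]\right)(s)=-\sum_{k=0}^{\infty}\frac{k!\,k\,\psi(\alpha k+\beta)}{\Gamma(\alpha k+\beta)}\,s^{-k-1},$$ $$\mathcal{L}\left(\frac{\partial}{\partial\beta}\left[E_{\alpha,\beta}(t)\right]\right)(s)=-\sum_{k=0}^{\infty}\frac{k!\,\psi(\alpha k+\beta)}{\Gamma(\alpha k+\beta)}\,s^{-k-1}.$$
   Context: $E_{\alpha,\beta}(z)=\sum_{k=0}^{\infty}\frac{z^k}{\Gamma(\alpha k+\beta)}$ is the two-parametric Mittag-Leffler function, with $1/\Gamma$ regarded as an entire function (zero at nonpositive integers). $\psi=\Gamma'/\Gamma$ is the digamma function, and $\psi(x)/\Gamma(x)$ is understood as $-(1/\Gamma)'(x)$, hence is defined for every real $x$ by continuity. The Laplace transform acts in the variable $t>0$: $\mathcal{L}(f(t))(s)=\int_0^\infty e^{-st}f(t)\,dt$ for $\mathrm{Re}\,s>0$. For other $s\in\mathbb{C}\setminus\{0\}$, $\mathcal{L}(f)(s)$ denotes the (single-valued) analytic continuation to $\mathbb{C}\setminus\{0\}$. *)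

theory Defs
  imports "HOL-Complex_Analysis.Complex_Analysis"
begin

text \<open>The library function \<^const>\<open>rGamma\<close> is the entire reciprocal Gamma function, which
  vanishes at the nonpositive integers. The class \<^class>\<open>Gamma\<close> covers real and complex arguments.\<close>

definition mittag_leffler :: "'a::Gamma \<Rightarrow> 'a \<Rightarrow> 'a \<Rightarrow> 'a" where
  "mittag_leffler \<alpha> \<beta> z = (\<Sum>k. z ^ k * rGamma (\<alpha> * of_nat k + \<beta>))"

text \<open>The quotient of the digamma and Gamma functions, extended continuously to the nonpositive
  integers. The naive quotient would be 0 there, because \<^const>\<open>Gamma\<close> is 0 at its poles.\<close>

definition Digamma_over_Gamma :: "real \<Rightarrow> real" where
  "Digamma_over_Gamma x = - deriv rGamma x"

lemma Digamma_over_Gamma_eq: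
  assumes "x \<notin> \<int>\<^sub>\<le>\<^sub>0"
  shows "Digamma_over_Gamma x = Digamma x / Gamma x"
proof -
  have "(rGamma has_field_derivative - rGamma x * Digamma x) (at x)"
    using assms by (rule has_field_derivative_rGamma_no_nonpos_int)
  hence "deriv rGamma x = - rGamma x * Digamma x"
    by (rule DERIV_imp_deriv)
  thus ?thesis
    by (simp add: Digamma_over_Gamma_def rGamma_inverse_Gamma field_simps)
qed

definition laplace_integrand :: "(real \<Rightarrow> real) \<Rightarrow> complex \<Rightarrow> real \<Rightarrow> complex" where
  "laplace_integrand f s t = exp (- s * of_real t) * of_real (f t)"

definition laplace_integral :: "(real \<Rightarrow> real) \<Rightarrow> complex \<Rightarrow> complex" where
  "laplace_integral f s = (LINT t:{0<..}|lborel. laplace_integrand f s t)"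

definition laplace_continuation :: "(real \<Rightarrow> real) \<Rightarrow> (complex \<Rightarrow> complex) \<Rightarrow> bool" where
  "laplace_continuation f F \<longleftrightarrow>
     F holomorphic_on (- {0}) \<and>
     (\<forall>s. Re s > 0 \<longrightarrow>
        set_integrable lborel {0<..} (laplace_integrand f s) \<and> F s = laplace_integral f s)"

text \<open>Outside the right half-plane, the value at \<open>s \<noteq> 0\<close> is that of the continuation, provided one
  exists; it is then unique by the lemma below. The value at 0 carries no meaning.\<close>

definition laplace :: "(real \<Rightarrow> real) \<Rightarrow> complex \<Rightarrow> complex" where
  "laplace f s =
     (if Re s > 0 then laplace_integral f s
      else (THE w. \<exists>F. laplace_continuation f F \<and> w = F s))"

lemma laplace_continuation_unique:
  assumes F: "laplace_continuation f F" and G: "laplace_continuation f G" and "s \<noteq> 0"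
  shows "F s = G s"
proof -
  have conn: "connected (- {0::complex})"
    by (rule connected_punctured_universe) simp
  have hol: "(\<lambda>z. F z - G z) holomorphic_on - {0}"
    using F G by (auto simp: laplace_continuation_def intro!: holomorphic_intros)
  have "F s - G s = 0"
  proof (rule analytic_continuation_open[where f = "\<lambda>z. F z - G z" and g = "\<lambda>_. 0"
        and s = "{z. Re z > 0}" and s' = "- {0}"])
    show "open {z. Re z > 0}" by (rule open_halfspace_Re_gt)
    have "1 \<in> {z. Re z > 0}" by simp
    thus "{z. Re z > 0} \<noteq> {}" by blast
    show "F z - G z = 0" if "z \<in> {z. Re z > 0}" for z
      using that F G by (simp add: laplace_continuation_def)
  qed (use conn hol \<open>s \<noteq> 0\<close> in auto)
  thus ?thesis by simp
qed

lemma laplace_eq_continuation: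
  assumes "laplace_continuation f F" and "s \<noteq> 0"
  shows "laplace f s = F s"
proof (cases "Re s > 0")
  case True
  thus ?thesis using assms by (simp add: laplace_def laplace_continuation_def)
next
  case False
  have "(THE w. \<exists>G. laplace_continuation f G \<and> w = G s) = F s"
    using assms laplace_continuation_unique by (intro the_equality) blast+
  thus ?thesis using False by (simp add: laplace_def)
qed

end

theory Submission
  imports Defs "HOL-Probability.Distributions"
begin

text \<open>The series \<open>\<Sum>k. t ^ k / \<Gamma>(\<alpha> k + \<beta>)\<close> may be differentiated termwise in \<open>\<alpha>\<close> or \<open>\<beta>\<close>, so each
  parameter derivative is a power series \<open>\<Sum>k. w k * t ^ k\<close> in \<open>t\<close>, and the Laplace transform may then
  be applied to each power of \<open>t\<close>: it turns \<open>t ^ k\<close> into \<open>k! / s ^ (k + 1)\<close>. The resulting series is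
  an entire function of \<open>1 / s\<close>, hence it is the analytic continuation to the punctured plane.

  Both interchanges are justified by one estimate: \<open>k! |w k| r ^ k\<close> is summable for every \<open>r\<close>
  (\<open>summable_fact_rGamma\<close> together with \<open>abs_deriv_rGamma_le\<close>). It is here that \<open>\<alpha> > 1\<close> enters.
  Convexity of \<open>ln \<Gamma>\<close> puts its graph above the tangent at \<open>x\<close>, so that
  \<open>\<Gamma>(x + y) \<ge> \<Gamma>(x) exp (y \<psi>(x))\<close> for \<open>y \<ge> 0\<close>.
  Take \<open>x = k + 2\<close>: as \<open>\<alpha> > 1\<close>, the argument \<open>\<alpha> k + \<beta>\<close> exceeds \<open>k + 2\<close> by at least \<open>\<epsilon> k\<close> for some
  \<open>\<epsilon> > 0\<close> and all large \<open>k\<close>. The factor \<open>\<Gamma>(k + 2)\<close> absorbs the factorial, and since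
  \<open>\<psi>(k + 2)\<close> grows without bound, like the harmonic numbers, the remaining factor
  \<open>exp (\<epsilon> k \<psi>(k + 2))\<close> beats every geometric sequence. The factor \<open>\<psi>\<close> in the derivative of
  \<open>1/\<Gamma>\<close> costs only a shift of the argument by 1, because \<open>\<psi>(x) \<le> x\<close> and
  \<open>(x - 1) / \<Gamma>(x) = 1 / \<Gamma>(x - 1)\<close>.

  The two parameters are treated together: along either one, the \<open>k\<close>-th argument of \<open>1/\<Gamma>\<close> is an
  affine function \<open>c k * q + d k\<close> of the moving parameter \<open>q\<close>.\<close>

section \<open>Decay of the reciprocal Gamma function\<close>

text \<open>Digamma is the increasing derivative of \<open>ln \<Gamma>\<close>, so the mean value theorem gives the tangent
  inequality for \<open>ln \<Gamma>\<close>; here it is exponentiated.\<close>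

lemma rGamma_add_le:
  fixes x y :: real
  assumes "x > 0" "y \<ge> 0"
  shows "rGamma (x + y) \<le> rGamma x * exp (- (y * Digamma x))"
proof (cases "y = 0")
  case False
  with assms have y: "y > 0" by simp
  have "\<exists>\<xi>. x < \<xi> \<and> \<xi> < x + y \<and> ln_Gamma (x + y) - ln_Gamma x = (x + y - x) * Digamma \<xi>"
    using assms y by (intro MVT2 has_field_derivative_ln_Gamma_real) auto
  then obtain \<xi> where \<xi>: "x < \<xi>" "ln_Gamma (x + y) - ln_Gamma x = y * Digamma \<xi>"
    by auto
  have "y * Digamma x \<le> ln_Gamma (x + y) - ln_Gamma x"
    unfolding \<xi>(2) using assms \<xi>(1) by (intro mult_left_mono Digamma_real_mono) auto
  hence "exp (- ln_Gamma (x + y)) \<le> exp (- ln_Gamma x - y * Digamma x)"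
    by simp
  thus ?thesis
    using assms by (simp add: rGamma_inverse_Gamma Gamma_real_pos_exp exp_minus exp_diff field_simps)
qed simp

lemma rGamma_antimono:
  fixes x y :: real
  assumes "3/2 \<le> x" "x \<le> y"
  shows "rGamma y \<le> rGamma x"
proof -
  have "rGamma (x + (y - x)) \<le> rGamma x * exp (- ((y - x) * Digamma x))"
    using assms by (intro rGamma_add_le) auto
  also have "\<dots> \<le> rGamma x * 1"
  proof (rule mult_left_mono)
    show "exp (- ((y - x) * Digamma x)) \<le> 1"
      using assms Digamma_real_ge_three_halves_pos[of x] by simp
    show "0 \<le> rGamma x"
      using assms by (simp add: rGamma_inverse_Gamma)
  qed
  finally show ?thesis by simp
qed

lemma Digamma_real_le_self:
  assumes "x \<ge> 1"
  shows "Digamma x \<le> (x::real)"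
proof -
  define n where "n = nat \<lfloor>x\<rfloor>"
  have n: "n \<le> x" "x \<le> real (Suc n)" using assms unfolding n_def by linarith+
  have "harm n \<le> (\<Sum>k=1..n. 1::real)"
    unfolding harm_def by (intro sum_mono) (auto simp: field_simps)
  hence harm: "harm n \<le> real n" by simp
  have "Digamma x \<le> Digamma (real (Suc n))"
    using assms n by (intro Digamma_real_mono) auto
  also have "\<dots> = harm n - euler_mascheroni" by (rule Digamma_of_nat)
  also have "\<dots> \<le> x" using harm n(1) euler_mascheroni_pos by simp
  finally show ?thesis .
qed

text \<open>For \<open>x \<ge> 3\<close> the derivative is \<open>- \<psi>(x) / \<Gamma>(x)\<close> with \<open>0 \<le> \<psi>(x) \<le> x \<le> 2 (x - 1)\<close>, and
  the factor \<open>x - 1\<close> is absorbed by the functional equation. Having \<open>y\<close> on the right instead of \<open>x\<close>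
  makes the bound uniform in a parameter on which \<open>x\<close> depends.\<close>

lemma abs_deriv_rGamma_le:
  fixes x y :: real
  assumes "3 \<le> y" "y \<le> x"
  shows "\<bar>deriv rGamma x\<bar> \<le> 2 * rGamma (y - 1)"
proof -
  have nonneg: "rGamma x \<ge> 0" "Digamma x \<ge> 0"
    using assms Digamma_real_ge_three_halves_pos[of x] by (simp_all add: rGamma_inverse_Gamma)
  have "x \<notin> \<int>\<^sub>\<le>\<^sub>0" using assms by (auto elim!: nonpos_Ints_cases)
  hence "deriv rGamma x = - rGamma x * Digamma x"
    by (intro DERIV_imp_deriv has_field_derivative_rGamma_no_nonpos_int)
  hence "\<bar>deriv rGamma x\<bar> = rGamma x * Digamma x"
    using nonneg by (simp add: abs_mult)
  also have "\<dots> \<le> rGamma x * x"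
    using assms nonneg by (intro mult_left_mono Digamma_real_le_self) auto
  also have "\<dots> \<le> rGamma x * (2 * (x - 1))"
    using assms nonneg by (intro mult_left_mono) auto
  also have "\<dots> = 2 * rGamma (x - 1)"
    using rGamma_plus1[of "x - 1"] by (simp add: algebra_simps)
  also have "\<dots> \<le> 2 * rGamma (y - 1)"
    using assms by (intro mult_left_mono rGamma_antimono) auto
  finally show ?thesis .
qed

lemma eventually_linear_ge:
  fixes a b c :: real
  assumes "a > 0"
  shows "eventually (\<lambda>k. a * real k + b \<ge> c) sequentially"
proof -
  have "filterlim (\<lambda>k. a * real k) at_top sequentially"
    using assms by (intro filterlim_tendsto_pos_mult_at_top[OF tendsto_const] filterlim_real_sequentially)
  hence "eventually (\<lambda>k. a * real k \<ge> c - b) sequentially"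
    by (simp add: filterlim_at_top)
  thus ?thesis by eventually_elim simp
qed

text \<open>Comparison with \<open>(1/2) ^ k\<close> by the tangent inequality at \<open>x = k + 2\<close>, where
  \<open>k! (k + 1) / \<Gamma>(k + 2) = 1\<close>.\<close>

lemma summable_fact_rGamma:
  fixes a b r :: real
  assumes "a > 1" "r \<ge> 0"
  shows "summable (\<lambda>k. fact k * (real k + 1) * rGamma (a * real k + b) * r ^ k)"
proof (rule summable_comparison_test_ev)
  define \<epsilon> where "\<epsilon> = (a - 1) / 2"
  have \<epsilon>: "\<epsilon> > 0" using assms by (simp add: \<epsilon>_def)
  \<comment> \<open>One \<open>\<epsilon> k\<close> absorbs the constant \<open>b - 2\<close>, the other one drives the decay.\<close>
  have a_eq: "a = 1 + 2 * \<epsilon>" by (simp add: \<epsilon>_def field_simps)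
  \<comment> \<open>With \<open>\<psi>(k + 2) \<ge> ln (2 r + 1) / \<epsilon>\<close>, the decay factor \<open>exp (- \<epsilon> k \<psi>(k + 2))\<close> is at most
    \<open>(1 / (2 r + 1)) ^ k\<close>, and \<open>r / (2 r + 1) \<le> 1/2\<close>.\<close>
  have "filterlim (\<lambda>k. - euler_mascheroni + harm (Suc k) :: real) at_top sequentially"
    by (intro filterlim_tendsto_add_at_top[OF tendsto_const])
       (use harm_at_top filterlim_sequentially_Suc in blast)
  hence "eventually (\<lambda>k. - euler_mascheroni + harm (Suc k) \<ge> ln (2 * r + 1) / \<epsilon>) sequentially"
    by (simp add: filterlim_at_top)
  moreover have "eventually (\<lambda>k. \<epsilon> * real k + b \<ge> 2) sequentially"
    using \<epsilon> by (rule eventually_linear_ge)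
  ultimately show "eventually (\<lambda>k. norm (fact k * (real k + 1) * rGamma (a * real k + b) * r ^ k)
                     \<le> (1/2) ^ k) sequentially"
  proof eventually_elim
    case (elim k)
    define x where "x = real (Suc (Suc k))"
    have Dx: "Digamma x \<ge> ln (2 * r + 1) / \<epsilon>"
      using elim(1) unfolding x_def Digamma_of_nat by simp
    have "ln (2 * r + 1) \<ge> 0" using assms by simp
    have ge: "a * real k + b - x \<ge> \<epsilon> * real k"
      using elim(2) unfolding x_def a_eq by (simp add: algebra_simps)
    hence ge0: "a * real k + b - x \<ge> 0"
      using \<epsilon> by (meson mult_nonneg_nonneg less_imp_le of_nat_0_le_iff order_trans)
    have fact_eq: "fact k * (real k + 1) * rGamma x = 1"
    proof -
      have "rGamma x = inverse ((real k + 1) * fact k)"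
        using Gamma_fact[of "Suc k", where 'a = real] unfolding x_def
        by (simp add: rGamma_inverse_Gamma fact_Suc add_ac del: fact_Suc) (simp add: add_ac)
      hence "fact k * (real k + 1) * rGamma x = ((real k + 1) * fact k) * inverse ((real k + 1) * fact k)"
        by (simp only: mult.commute[of "fact k"])
      also have "\<dots> = 1"
        by (intro right_inverse) (simp add: add_nonneg_eq_0_iff)
      finally show ?thesis .
    qed
    have "rGamma (a * real k + b) \<le> rGamma x * exp (- ((a * real k + b - x) * Digamma x))"
      using rGamma_add_le[of x "a * real k + b - x"] ge0 by (simp add: x_def)
    also have "\<dots> \<le> rGamma x * exp (- (\<epsilon> * real k * (ln (2 * r + 1) / \<epsilon>)))"
    proof (intro mult_left_mono)
      show "exp (- ((a * real k + b - x) * Digamma x)) \<le> exp (- (\<epsilon> * real k * (ln (2 * r + 1) / \<epsilon>)))"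
        using mult_mono[OF ge Dx ge0] \<open>ln (2 * r + 1) \<ge> 0\<close> \<epsilon> by simp
    qed (simp add: x_def rGamma_inverse_Gamma)
    also have "exp (- (\<epsilon> * real k * (ln (2 * r + 1) / \<epsilon>))) = (1 / (2 * r + 1)) ^ k"
      using \<epsilon> assms by (simp add: exp_minus exp_of_nat_mult power_divide inverse_eq_divide)
    finally have "rGamma (a * real k + b) \<le> rGamma x * (1 / (2 * r + 1)) ^ k" .
    hence "fact k * (real k + 1) * rGamma (a * real k + b) * r ^ k
             \<le> fact k * (real k + 1) * (rGamma x * (1 / (2 * r + 1)) ^ k) * r ^ k"
      using assms by (intro mult_left_mono mult_right_mono) auto
    also have "\<dots> = (r / (2 * r + 1)) ^ k"
      using fact_eq by (simp add: mult.assoc[symmetric] power_divide)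
    also have "\<dots> \<le> (1/2) ^ k"
      using assms by (intro power_mono) (auto simp: field_simps)
    finally have le: "fact k * (real k + 1) * rGamma (a * real k + b) * r ^ k \<le> (1/2) ^ k" .
    have "a * real k + b > 0" using ge0 by (simp add: x_def)
    hence "rGamma (a * real k + b) \<ge> 0" by (simp add: rGamma_inverse_Gamma)
    thus ?case using le assms by simp
  qed
qed (simp add: summable_geometric)

section \<open>Termwise differentiation in a parameter\<close>

text \<open>The lower bound \<open>a k + b\<close> on the arguments of \<open>1/\<Gamma>\<close> holds for all parameters near \<open>p\<close> and has
  slope \<open>a > 1\<close>, so a single series, twice the one of \<open>summable_fact_rGamma\<close> with \<open>b - 1\<close> for \<open>b\<close>,
  majorizes the differentiated terms uniformly, and the Weierstrass test applies. The same majorant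
  dominates the terms multiplied by the factorials that the Laplace transform introduces.\<close>

lemma parameter_derivative_rGamma_series:
  fixes c d :: "nat \<Rightarrow> real" and p \<delta> a b :: real
  assumes "\<delta> > 0" "a > 1"
  assumes c: "\<And>k. \<bar>c k\<bar> \<le> real k + 1"
  assumes lower: "\<And>q k. \<bar>q - p\<bar> < \<delta> \<Longrightarrow> a * real k + b \<le> c k * q + d k"
  shows
    summable_fact_parameter_derivative:
      "r \<ge> 0 \<Longrightarrow> summable (\<lambda>k. fact k * \<bar>c k * deriv rGamma (c k * p + d k)\<bar> * r ^ k)" and
    has_field_derivative_parameter:
      "((\<lambda>q. \<Sum>k. t ^ k * rGamma (c k * q + d k)) has_field_derivative
          (\<Sum>k. t ^ k * (c k * deriv rGamma (c k * p + d k)))) (at p)"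
proof -
  have ev: "eventually (\<lambda>k. a * real k + b \<ge> 3) sequentially"
    using assms by (intro eventually_linear_ge) auto
  define M where "M r k = 2 * (fact k * (real k + 1) * rGamma (a * real k + (b - 1)) * r ^ k)"
    for r :: real and k :: nat
  have M_summable: "summable (M r)" if "r \<ge> 0" for r
    unfolding M_def using assms that by (intro summable_mult summable_fact_rGamma) auto
  have bound: "\<bar>c k * deriv rGamma (c k * q + d k)\<bar> \<le> (real k + 1) * (2 * rGamma (a * real k + (b - 1)))"
    if "a * real k + b \<ge> 3" "\<bar>q - p\<bar> < \<delta>" for k q
  proof -
    have "\<bar>deriv rGamma (c k * q + d k)\<bar> \<le> 2 * rGamma (a * real k + b - 1)"
      using that lower by (intro abs_deriv_rGamma_le) auto
    hence "\<bar>c k\<bar> * \<bar>deriv rGamma (c k * q + d k)\<bar> \<le> (real k + 1) * (2 * rGamma (a * real k + b - 1))"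
      using c by (intro mult_mono) auto
    thus ?thesis by (simp add: abs_mult algebra_simps)
  qed
  show "summable (\<lambda>k. fact k * \<bar>c k * deriv rGamma (c k * p + d k)\<bar> * r ^ k)" if r: "r \<ge> 0"
  proof (rule summable_comparison_test_ev[OF _ M_summable[OF r]])
    show "eventually (\<lambda>k. norm (fact k * \<bar>c k * deriv rGamma (c k * p + d k)\<bar> * r ^ k) \<le> M r k) sequentially"
      using ev
    proof eventually_elim
      case (elim k)
      have "fact k * \<bar>c k * deriv rGamma (c k * p + d k)\<bar> * r ^ k
              \<le> fact k * ((real k + 1) * (2 * rGamma (a * real k + (b - 1)))) * r ^ k"
        using bound[OF elim, of p] r \<open>\<delta> > 0\<close> by (intro mult_left_mono mult_right_mono) auto
      thus ?case using r by (simp add: M_def abs_mult algebra_simps)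
    qed
  qed
  have convergent: "uniformly_convergent_on (ball p \<delta>)
          (\<lambda>n q. \<Sum>k<n. t ^ k * (c k * deriv rGamma (c k * q + d k)))"
  proof (rule Weierstrass_m_test'_ev[OF _ M_summable])
    show "eventually (\<lambda>k. \<forall>q\<in>ball p \<delta>. norm (t ^ k * (c k * deriv rGamma (c k * q + d k))) \<le> M \<bar>t\<bar> k) sequentially"
      using ev
    proof eventually_elim
      case (elim k)
      show ?case
      proof
        fix q assume q: "q \<in> ball p \<delta>"
        have "\<bar>t\<bar> ^ k * \<bar>c k * deriv rGamma (c k * q + d k)\<bar>
                \<le> \<bar>t\<bar> ^ k * ((real k + 1) * (2 * rGamma (a * real k + (b - 1))))"
          using q by (intro mult_left_mono bound elim) (auto simp: dist_real_def)
        also have "\<dots> \<le> fact k * (\<bar>t\<bar> ^ k * ((real k + 1) * (2 * rGamma (a * real k + (b - 1)))))"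
        proof -
          have "rGamma (a * real k + (b - 1)) \<ge> 0"
            using elim by (simp add: rGamma_inverse_Gamma)
          hence "0 \<le> \<bar>t\<bar> ^ k * ((real k + 1) * (2 * rGamma (a * real k + (b - 1))))"
            by simp
          from mult_right_mono[OF fact_ge_1[of k, where 'a = real] this] show ?thesis by simp
        qed
        finally show "norm (t ^ k * (c k * deriv rGamma (c k * q + d k))) \<le> M \<bar>t\<bar> k"
          by (simp add: M_def abs_mult power_abs algebra_simps)
      qed
    qed
  qed simp
  have summable_p: "summable (\<lambda>k. t ^ k * rGamma (c k * p + d k))"
  proof (rule summable_comparison_test_ev)
    show "summable (\<lambda>k. fact k * (real k + 1) * rGamma (a * real k + b) * \<bar>t\<bar> ^ k)"
      using assms by (intro summable_fact_rGamma) auto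
    show "eventually (\<lambda>k. norm (t ^ k * rGamma (c k * p + d k))
             \<le> fact k * (real k + 1) * rGamma (a * real k + b) * \<bar>t\<bar> ^ k) sequentially"
      using ev
    proof eventually_elim
      case (elim k)
      have le: "a * real k + b \<le> c k * p + d k" using lower[of p k] \<open>\<delta> > 0\<close> by simp
      have nonneg: "rGamma (c k * p + d k) \<ge> 0" using le elim by (simp add: rGamma_inverse_Gamma)
      have "1 * (\<bar>t\<bar> ^ k * rGamma (c k * p + d k))
              \<le> (fact k * (real k + 1)) * (\<bar>t\<bar> ^ k * rGamma (a * real k + b))"
      proof (intro mult_mono rGamma_antimono)
        show "1 \<le> fact k * (real k + 1)"
          using mult_mono[of 1 "fact k" 1 "real k + 1"] fact_ge_1[of k, where 'a = real] by simp
      qed (use elim le nonneg in auto)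
      thus ?case using nonneg by (simp add: abs_mult power_abs algebra_simps)
    qed
  qed
  show "((\<lambda>q. \<Sum>k. t ^ k * rGamma (c k * q + d k)) has_field_derivative
          (\<Sum>k. t ^ k * (c k * deriv rGamma (c k * p + d k)))) (at p)"
  proof (rule has_field_derivative_series'(2)[where S = "ball p \<delta>" and ?x0.0 = p])
    show "uniformly_convergent_on (ball p \<delta>)
            (\<lambda>n q. \<Sum>k<n. t ^ k * (c k * deriv rGamma (c k * q + d k)))"
      by (rule convergent)
    show "summable (\<lambda>k. t ^ k * rGamma (c k * p + d k))"
      by (rule summable_p)
  next
    fix k and q :: real
    have "rGamma field_differentiable at (c k * q + d k)"
      unfolding field_differentiable_def using has_field_derivative_rGamma by blast
    hence "(rGamma has_field_derivative deriv rGamma (c k * q + d k)) (at (c k * q + d k))"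
      by (simp add: DERIV_deriv_iff_field_differentiable)
    moreover have "((\<lambda>q. c k * q + d k) has_field_derivative c k) (at q within ball p \<delta>)"
      by (auto intro!: derivative_eq_intros)
    ultimately have "((\<lambda>q. rGamma (c k * q + d k)) has_field_derivative
                       deriv rGamma (c k * q + d k) * c k) (at q within ball p \<delta>)"
      by (rule DERIV_chain2)
    from DERIV_cmult[OF this, of "t ^ k"]
    show "((\<lambda>q. t ^ k * rGamma (c k * q + d k)) has_field_derivative
            t ^ k * (c k * deriv rGamma (c k * q + d k))) (at q within ball p \<delta>)"
      by (simp add: mult_ac)
  qed (use \<open>\<delta> > 0\<close> in auto)
qed

section \<open>Laplace transforms of powers and of power series\<close>

text \<open>The norm of the integrand is the real integrand with \<open>s\<close> replaced by \<open>Re s\<close>, which is reduced to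
  Euler's integral by scaling.\<close>

lemma laplace_power_integrable:
  fixes s :: complex
  assumes "Re s > 0"
  shows "set_integrable lborel {0<..} (\<lambda>t. exp (- s * of_real t) * of_real t ^ k)"
proof -
  define \<sigma> where "\<sigma> = Re s"
  have \<sigma>: "\<sigma> > 0" using assms by (simp add: \<sigma>_def)
  have "integrable lborel (\<lambda>x::real. indicator {0..} x *\<^sub>R (x ^ k * exp (- x)))"
  proof (rule integrableI_nonneg)
    have "(\<integral>\<^sup>+ x. ennreal (indicator {0..} x *\<^sub>R (x ^ k * exp (- x))) \<partial>lborel) =
          (\<integral>\<^sup>+ x. ennreal (x ^ k * exp (- x)) * indicator {0..} x \<partial>lborel)"
      by (intro nn_integral_cong) (auto split: split_indicator)
    also have "\<dots> = real_of_nat (fact k)" by (rule nn_intergal_power_times_exp_Ici)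
    finally show "(\<integral>\<^sup>+ x. ennreal (indicator {0..} x *\<^sub>R (x ^ k * exp (- x))) \<partial>lborel) < \<infinity>"
      by simp
  qed (auto split: split_indicator)
  from lborel_integrable_real_affine[OF this, of \<sigma> 0] \<sigma>
  have "integrable lborel (\<lambda>x::real. indicator {0..} (\<sigma> * x) *\<^sub>R ((\<sigma> * x) ^ k * exp (- (\<sigma> * x))))"
    by simp
  hence "integrable lborel (\<lambda>x::real. inverse (\<sigma> ^ k) * (indicator {0..} (\<sigma> * x) *\<^sub>R ((\<sigma> * x) ^ k * exp (- (\<sigma> * x)))))"
    by (rule integrable_mult_right)
  thus ?thesis
    unfolding set_integrable_def
  proof (rule Bochner_Integration.integrable_bound)
    show "(\<lambda>t. indicator {0<..} t *\<^sub>R (exp (- s * complex_of_real t) * complex_of_real t ^ k))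
            \<in> borel_measurable lborel"
      by measurable
    show "AE x in lborel. norm (indicator {0<..} x *\<^sub>R (exp (- s * complex_of_real x) * complex_of_real x ^ k))
            \<le> norm (inverse (\<sigma> ^ k) * (indicator {0..} (\<sigma> * x) *\<^sub>R ((\<sigma> * x) ^ k * exp (- (\<sigma> * x)))))"
      using \<sigma> by (intro AE_I2) (auto split: split_indicator
        simp: norm_mult norm_power power_mult_distrib field_simps \<sigma>_def zero_le_mult_iff)
  qed
qed

lemma power_times_exp_tendsto_0:
  fixes s :: complex
  assumes "Re s > 0"
  shows "((\<lambda>t. exp (- s * of_real t) * of_real t ^ k) \<longlongrightarrow> 0) at_top"
proof (rule tendsto_norm_zero_cancel)
  have "((\<lambda>t. (Re s * t) ^ k / exp (Re s * t) / Re s ^ k) \<longlongrightarrow> 0 / Re s ^ k) at_top"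
    using assms
    by (intro tendsto_divide filterlim_compose[OF tendsto_power_div_exp_0] tendsto_const
          filterlim_tendsto_pos_mult_at_top[OF tendsto_const _ filterlim_ident]) auto
  moreover have "eventually (\<lambda>t. norm (exp (- s * of_real t) * of_real t ^ k)
                     = (Re s * t) ^ k / exp (Re s * t) / Re s ^ k) at_top"
    using eventually_ge_at_top[of 0]
  proof eventually_elim
    case (elim t)
    have "norm (exp (- s * of_real t) * of_real t ^ k) = exp (- (Re s * t)) * t ^ k"
      using elim by (simp add: norm_mult norm_power)
    also have "\<dots> = (Re s * t) ^ k / exp (Re s * t) / Re s ^ k"
      using assms by (simp add: exp_minus power_mult_distrib field_simps)
    finally show ?case .
  qed
  ultimately show "((\<lambda>t. norm (exp (- s * of_real t) * of_real t ^ k)) \<longlongrightarrow> 0) at_top"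
    by (simp add: filterlim_cong[OF refl refl])
qed

lemma integral_of_derivative_half_line:
  fixes s :: complex and F f :: "real \<Rightarrow> complex"
  assumes "\<And>t. t > 0 \<Longrightarrow> (F has_vector_derivative f t) (at t)"
    and "continuous_on {0<..} f"
    and int: "set_integrable lborel {0<..} f"
    and lim0: "(F \<longlongrightarrow> A) (at_right 0)" and lim1: "(F \<longlongrightarrow> B) at_top"
  shows "(LINT t:{0<..}|lborel. f t) = B - A"
proof -
  have "(LBINT t=ereal 0..\<infinity>. f t) = B - A"
  proof (rule interval_integral_FTC_integrable)
    show "isCont f x" if "ereal 0 < ereal x" for x
      using that assms(2) by (simp add: continuous_on_eq_continuous_at)
    show "((F \<circ> real_of_ereal) \<longlongrightarrow> A) (at_right (ereal 0))"
      using lim0 unfolding ereal_tendsto_simps .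
    show "((F \<circ> real_of_ereal) \<longlongrightarrow> B) (at_left \<infinity>)"
      using lim1 unfolding ereal_tendsto_simps .
  qed (use assms(1) int in \<open>auto simp: einterval_eq_Ici\<close>)
  thus ?thesis
    by (simp add: interval_lebesgue_integral_def einterval_eq_Ici)
qed

text \<open>Integrating the derivative of \<open>exp (- s t) t ^ (k + 1)\<close>, whose boundary values vanish, relates
  the transform of \<open>t ^ (k + 1)\<close> to that of \<open>t ^ k\<close>.\<close>

lemma laplace_power:
  fixes s :: complex
  assumes "Re s > 0"
  shows "(LINT t:{0<..}|lborel. exp (- s * of_real t) * of_real t ^ k) = fact k / s ^ Suc k"
proof (induction k)
  case 0
  have s: "s \<noteq> 0" using assms by auto
  have "(LINT t:{0<..}|lborel. exp (- s * of_real t)) = 0 - (- 1 / s)"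
  proof (rule integral_of_derivative_half_line)
    show "((\<lambda>t. - exp (- s * of_real t) / s) has_vector_derivative exp (- s * of_real t)) (at t)" for t
    proof -
      have "((\<lambda>z. - exp (- s * z) / s) has_field_derivative exp (- s * of_real t)) (at (of_real t))"
        using s by (auto intro!: derivative_eq_intros)
      thus ?thesis by (rule has_vector_derivative_real_field)
    qed
    show "set_integrable lborel {0<..} (\<lambda>t. exp (- s * complex_of_real t))"
      using laplace_power_integrable[OF assms, of 0] by simp
    have "((\<lambda>t. - exp (- s * complex_of_real t) / s) \<longlongrightarrow> - exp (- s * of_real 0) / s) (at_right 0)"
      using s by (intro tendsto_intros) auto
    thus "((\<lambda>t. - exp (- s * complex_of_real t) / s) \<longlongrightarrow> - 1 / s) (at_right 0)" by simp
    have "((\<lambda>t. - exp (- s * complex_of_real t) / s) \<longlongrightarrow> - 0 / s) at_top"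
      using power_times_exp_tendsto_0[OF assms, of 0] s
      by (intro tendsto_divide tendsto_minus tendsto_const) auto
    thus "((\<lambda>t. - exp (- s * complex_of_real t) / s) \<longlongrightarrow> 0) at_top" by simp
  qed (auto intro!: continuous_intros)
  thus ?case by simp
next
  case (Suc k)
  have s: "s \<noteq> 0" using assms by auto
  let ?I = "\<lambda>k. LINT t:{0<..}|lborel. exp (- s * of_real t) * of_real t ^ k"
  let ?g = "\<lambda>k t. exp (- s * complex_of_real t) * complex_of_real t ^ k"
  note int = laplace_power_integrable[OF assms]
  have "(LINT t:{0<..}|lborel. of_nat (Suc k) * ?g k t - s * ?g (Suc k) t) = 0 - 0"
  proof (rule integral_of_derivative_half_line)
    show "(?g (Suc k) has_vector_derivative of_nat (Suc k) * ?g k t - s * ?g (Suc k) t) (at t)" for t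
    proof -
      have "((\<lambda>z. exp (- s * z) * z ^ Suc k) has_field_derivative
              of_nat (Suc k) * (exp (- s * of_real t) * of_real t ^ k)
                - s * (exp (- s * of_real t) * of_real t ^ Suc k)) (at (of_real t))"
        by (rule derivative_eq_intros refl | simp add: algebra_simps)+
      thus ?thesis by (rule has_vector_derivative_real_field)
    qed
    show "set_integrable lborel {0<..} (\<lambda>t. of_nat (Suc k) * ?g k t - s * ?g (Suc k) t)"
      by (intro set_integral_diff set_integrable_mult_right int)
    have "(?g (Suc k) \<longlongrightarrow> exp (- s * of_real 0) * of_real 0 ^ Suc k) (at_right 0)"
      by (intro tendsto_intros)
    thus "(?g (Suc k) \<longlongrightarrow> 0) (at_right 0)" by simp
    show "(?g (Suc k) \<longlongrightarrow> 0) at_top" by (rule power_times_exp_tendsto_0[OF assms])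
  qed (auto intro!: continuous_intros)
  also have "(LINT t:{0<..}|lborel. of_nat (Suc k) * ?g k t - s * ?g (Suc k) t)
               = of_nat (Suc k) * ?I k - s * ?I (Suc k)"
    using int by (subst set_integral_diff) (auto simp only: set_integral_mult_right set_integrable_mult_right)
  finally have "s * ?I (Suc k) = of_nat (Suc k) * ?I k" by simp
  hence "?I (Suc k) = of_nat (Suc k) * ?I k / s" using s by (simp add: field_simps)
  also have "\<dots> = fact (Suc k) / s ^ Suc (Suc k)" unfolding Suc by simp
  finally show ?case .
qed

lemma powi_minus_Suc: "(s::complex) powi (- int k - 1) = inverse s * inverse s ^ k"
proof -
  have "- int k - 1 = - int (Suc k)" by simp
  thus ?thesis by (simp only: power_int_minus power_int_of_nat power_inverse power_Suc inverse_mult_distrib)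
qed

text \<open>On \<open>Re s > 0\<close>, dominated convergence permits integrating term by term: the norms of the terms
  have integrals \<open>k! |a k| / (Re s) ^ (k + 1)\<close>, which are summable by assumption. The series obtained
  is \<open>1/s\<close> times a power series in \<open>1/s\<close> that converges everywhere, so it is holomorphic wherever
  \<open>1/s\<close> is.\<close>

lemma laplace_entire_series:
  fixes a :: "nat \<Rightarrow> real" and f :: "real \<Rightarrow> real"
  assumes a: "\<And>r. r \<ge> 0 \<Longrightarrow> summable (\<lambda>k. fact k * \<bar>a k\<bar> * r ^ k)"
  assumes f: "\<And>t. t > 0 \<Longrightarrow> f t = (\<Sum>k. a k * t ^ k)"
  shows "summable (\<lambda>k. fact k * of_real (a k) * (s::complex) powi (- int k - 1))"
    and "laplace_continuation f (\<lambda>s. \<Sum>k. fact k * of_real (a k) * s powi (- int k - 1))"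
proof -
  have summable: "summable (\<lambda>k. fact k * of_real (a k) * z ^ k)" for z :: complex
    using a[of "norm z"] by - (rule summable_norm_cancel, simp add: norm_mult norm_power)
  thus "summable (\<lambda>k. fact k * of_real (a k) * s powi (- int k - 1))" for s :: complex
    using summable_mult[OF summable[of "inverse s"], of "inverse s"]
    by (simp add: powi_minus_Suc mult_ac)
  define G where "G z = (\<Sum>k. fact k * of_real (a k) * z ^ k)" for z :: complex
  have F_eq: "(\<Sum>k. fact k * of_real (a k) * s powi (- int k - 1)) = inverse s * G (inverse s)" for s :: complex
    unfolding G_def using suminf_mult[OF summable[of "inverse s"], of "inverse s"]
    by (simp add: powi_minus_Suc mult_ac)
  have "G holomorphic_on UNIV"
    unfolding holomorphic_on_def field_differentiable_def G_def
    using termdiffs_strong_converges_everywhere[OF summable] by blast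
  hence "(\<lambda>s. inverse s * G (inverse s)) holomorphic_on - {0}"
    by (intro holomorphic_intros holomorphic_on_compose_gen[of inverse _ G, unfolded o_def]) auto
  hence hol: "(\<lambda>s. \<Sum>k. fact k * of_real (a k) * s powi (- int k - 1)) holomorphic_on - {0::complex}"
    by (simp add: F_eq)
  show "laplace_continuation f (\<lambda>s. \<Sum>k. fact k * of_real (a k) * s powi (- int k - 1))"
    unfolding laplace_continuation_def
  proof (intro conjI hol allI impI)
    fix s :: complex assume s: "Re s > 0"
    define g where "g k t = indicator {0<..} t *\<^sub>R (of_real (a k) * (exp (- s * of_real t) * of_real t ^ k))"
      for k :: nat and t :: real
    have g_int: "integrable lborel (g k)" for k
      using set_integrable_mult_right[OF laplace_power_integrable[OF s, of k], of "of_real (a k)"]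
      unfolding set_integrable_def g_def by simp
    \<comment> \<open>The norm of \<open>g k\<close> is itself a Laplace integrand, at the real point \<open>Re s\<close>.\<close>
    have norm_g: "(LINT t|lborel. norm (g k t)) = \<bar>a k\<bar> * (fact k / Re s ^ Suc k)" for k
    proof -
      have "complex_of_real (LINT t|lborel. norm (g k t)) = (LINT t|lborel. complex_of_real (norm (g k t)))"
        by simp
      also have "\<dots> = (LINT t:{0<..}|lborel. of_real \<bar>a k\<bar> * (exp (- of_real (Re s) * of_real t) * of_real t ^ k))"
        unfolding set_lebesgue_integral_def g_def
        by (intro Bochner_Integration.integral_cong refl)
           (auto split: split_indicator simp: norm_mult norm_power exp_of_real[symmetric])
      also have "\<dots> = of_real \<bar>a k\<bar> * (fact k / of_real (Re s) ^ Suc k)"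
        using s by (simp only: set_integral_mult_right laplace_power Re_complex_of_real)
      also have "\<dots> = of_real (\<bar>a k\<bar> * (fact k / Re s ^ Suc k))" by simp
      finally show ?thesis by (simp only: of_real_eq_iff)
    qed
    have pointwise: "summable (\<lambda>k. \<bar>a k\<bar> * t ^ k)" if "t > 0" for t
    proof (rule summable_comparison_test'[OF a[of t]])
      show "norm (\<bar>a k\<bar> * t ^ k) \<le> fact k * \<bar>a k\<bar> * t ^ k" for k
        using that fact_ge_1[of k, where 'a = real] mult_right_mono[of 1 "fact k" "\<bar>a k\<bar> * t ^ k"]
        by (simp add: abs_mult mult_ac)
    qed (use that in auto)
    have ae: "AE t in lborel. summable (\<lambda>k. norm (g k t))"
    proof (rule AE_I2)
      fix t :: real
      show "summable (\<lambda>k. norm (g k t))"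
      proof (cases "t > 0")
        case True
        from summable_mult[OF pointwise[OF this], of "norm (exp (- s * of_real t))"] show ?thesis
          using True by (simp add: g_def norm_mult norm_power mult_ac)
      qed (simp add: g_def)
    qed
    have summable_int: "summable (\<lambda>k. LINT t|lborel. norm (g k t))"
      unfolding norm_g using summable_mult[OF a[of "inverse (Re s)"], of "inverse (Re s)"] s
      by (simp add: field_simps)
    have sum_g: "(\<Sum>k. g k t) = indicator {0<..} t *\<^sub>R laplace_integrand f s t" for t
    proof (cases "t > 0")
      case True
      have "summable (\<lambda>k. a k * t ^ k)"
        using pointwise[OF True] True by - (rule summable_norm_cancel, simp add: abs_mult)
      hence "(\<lambda>k. a k * t ^ k) sums f t" using f[OF True] by (simp add: summable_sums)
      hence "(\<lambda>k. exp (- s * of_real t) * of_real (a k * t ^ k)) sums (exp (- s * of_real t) * of_real (f t))"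
        by (intro sums_mult sums_of_real)
      thus ?thesis using True by (intro sums_unique[symmetric]) (simp add: g_def laplace_integrand_def mult_ac)
    qed (simp add: g_def)
    show "set_integrable lborel {0<..} (laplace_integrand f s)"
      using integrable_suminf[OF g_int ae summable_int] by (simp add: sum_g set_integrable_def)
    have "laplace_integral f s = (\<Sum>k. LINT t|lborel. g k t)"
      using integral_suminf[OF g_int ae summable_int]
      by (simp add: sum_g laplace_integral_def set_lebesgue_integral_def)
    also have "(\<lambda>k. LINT t|lborel. g k t) = (\<lambda>k. fact k * of_real (a k) * s powi (- int k - 1))"
    proof
      fix k
      have "(LINT t|lborel. g k t) = of_real (a k) * (fact k / s ^ Suc k)"
        using laplace_power[OF s, of k]
        by (simp only: g_def set_lebesgue_integral_def[symmetric] set_integral_mult_right)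
      thus "(LINT t|lborel. g k t) = fact k * of_real (a k) * s powi (- int k - 1)"
        by (simp add: powi_minus_Suc field_simps)
    qed
    finally show "(\<Sum>k. fact k * of_real (a k) * s powi (- int k - 1)) = laplace_integral f s" ..
  qed
qed

section \<open>The parameter derivatives of the Mittag-Leffler function\<close>

text \<open>The common form of both claims. The coefficients of the derivative carry \<open>(1/\<Gamma>)'\<close>, which is
  \<open>- \<psi>/\<Gamma>\<close> by definition at every real argument, poles of \<open>\<Gamma>\<close> included; this is the origin of the
  minus sign.\<close>

lemma laplace_parameter_derivative:
  fixes f :: "real \<Rightarrow> real \<Rightarrow> real" and c d :: "nat \<Rightarrow> real" and p \<delta> a b :: real
  assumes f: "\<And>q t. f q t = (\<Sum>k. t ^ k * rGamma (c k * q + d k))"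
  assumes \<delta>: "\<delta> > 0" and a: "a > 1"
  assumes c: "\<And>k. \<bar>c k\<bar> \<le> real k + 1"
  assumes lower: "\<And>q k. \<bar>q - p\<bar> < \<delta> \<Longrightarrow> a * real k + b \<le> c k * q + d k"
  defines "u \<equiv> (\<lambda>s k. fact k * complex_of_real (c k * Digamma_over_Gamma (c k * p + d k))
                         * s powi (- int k - 1))"
  shows "(\<lambda>q. f q t) field_differentiable at p"
    and "\<exists>F. laplace_continuation (\<lambda>t. deriv (\<lambda>q. f q t) p) F"
    and "s \<noteq> 0 \<Longrightarrow> summable (u s) \<and> laplace (\<lambda>t. deriv (\<lambda>q. f q t) p) s = - (\<Sum>k. u s k)"
proof -
  define w where "w k = c k * deriv rGamma (c k * p + d k)" for k
  have deriv_f: "((\<lambda>q. f q t) has_field_derivative (\<Sum>k. w k * t ^ k)) (at p)" for t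
    using has_field_derivative_parameter[where p = p and t = t, OF \<delta> a c lower]
    by (simp add: f w_def mult_ac)
  thus "(\<lambda>q. f q t) field_differentiable at p"
    by (auto simp: field_differentiable_def)
  have w: "summable (\<lambda>k. fact k * \<bar>w k\<bar> * r ^ k)" if "r \<ge> 0" for r
    using summable_fact_parameter_derivative[where p = p, OF \<delta> a c lower that] by (simp add: w_def)
  have "deriv (\<lambda>q. f q t) p = (\<Sum>k. w k * t ^ k)" for t
    using deriv_f by (rule DERIV_imp_deriv)
  note series = laplace_entire_series[of w, OF w this]
  have u: "u s = (\<lambda>k. - (fact k * of_real (w k) * s powi (- int k - 1)))" for s
    by (simp add: u_def w_def Digamma_over_Gamma_def)
  show "\<exists>F. laplace_continuation (\<lambda>t. deriv (\<lambda>q. f q t) p) F"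
    using series(2) by blast
  show "summable (u s) \<and> laplace (\<lambda>t. deriv (\<lambda>q. f q t) p) s = - (\<Sum>k. u s k)" if "s \<noteq> 0"
    using laplace_eq_continuation[OF series(2) that] suminf_minus[OF series(1)[of s]]
      summable_minus[OF series(1)[of s]]
    by (simp add: u)
qed

theorem theorem4:
  fixes \<alpha> \<beta> :: real
  assumes "\<alpha> > 1"
  shows
    "(\<forall>t>0. (\<lambda>a. mittag_leffler a \<beta> t) field_differentiable at \<alpha>) \<and>
     (\<exists>F. laplace_continuation (\<lambda>t. deriv (\<lambda>a. mittag_leffler a \<beta> t) \<alpha>) F) \<and>
     (\<forall>s. s \<noteq> 0 \<longrightarrow>
        summable (\<lambda>k. fact k * of_nat k * of_real (Digamma_over_Gamma (\<alpha> * real k + \<beta>))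
                       * s powi (- int k - 1)) \<and>
        laplace (\<lambda>t. deriv (\<lambda>a. mittag_leffler a \<beta> t) \<alpha>) s =
          - (\<Sum>k. fact k * of_nat k * of_real (Digamma_over_Gamma (\<alpha> * real k + \<beta>))
                       * s powi (- int k - 1))) \<and>
     (\<forall>t>0. (\<lambda>b. mittag_leffler \<alpha> b t) field_differentiable at \<beta>) \<and>
     (\<exists>F. laplace_continuation (\<lambda>t. deriv (\<lambda>b. mittag_leffler \<alpha> b t) \<beta>) F) \<and>
     (\<forall>s. s \<noteq> 0 \<longrightarrow>
        summable (\<lambda>k. fact k * of_real (Digamma_over_Gamma (\<alpha> * real k + \<beta>))
                       * s powi (- int k - 1)) \<and>
        laplace (\<lambda>t. deriv (\<lambda>b. mittag_leffler \<alpha> b t) \<beta>) s =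
          - (\<Sum>k. fact k * of_real (Digamma_over_Gamma (\<alpha> * real k + \<beta>))
                       * s powi (- int k - 1)))"
proof -
  have alpha: "(\<lambda>a. mittag_leffler a \<beta> t) field_differentiable at \<alpha>"
    "\<exists>F. laplace_continuation (\<lambda>t. deriv (\<lambda>a. mittag_leffler a \<beta> t) \<alpha>) F"
    "s \<noteq> 0 \<Longrightarrow>
       summable (\<lambda>k. fact k * of_real (real k * Digamma_over_Gamma (real k * \<alpha> + \<beta>))
                      * s powi (- int k - 1)) \<and>
       laplace (\<lambda>t. deriv (\<lambda>a. mittag_leffler a \<beta> t) \<alpha>) s =
         - (\<Sum>k. fact k * of_real (real k * Digamma_over_Gamma (real k * \<alpha> + \<beta>))
                    * s powi (- int k - 1))" for s t
  proof -
    \<comment> \<open>Half-way between 1 and \<open>\<alpha>\<close>: the parameter may move by \<open>(\<alpha> - 1) / 2\<close> and the slope of the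
      arguments still stays above \<open>(\<alpha> + 1) / 2 > 1\<close>.\<close>
    have lower: "(\<alpha> + 1) / 2 * real k + \<beta> \<le> real k * q + \<beta>" if "\<bar>q - \<alpha>\<bar> < (\<alpha> - 1) / 2" for q k
    proof -
      have "(\<alpha> + 1) / 2 \<le> q" using that abs_ge_minus_self[of "q - \<alpha>"] by (simp add: field_simps)
      hence "(\<alpha> + 1) / 2 * real k \<le> q * real k" by (rule mult_right_mono) simp
      thus ?thesis by (simp add: mult.commute)
    qed
    note * = laplace_parameter_derivative[where f = "\<lambda>a t. mittag_leffler a \<beta> t"
        and c = real and d = "\<lambda>_. \<beta>" and p = \<alpha> and \<delta> = "(\<alpha> - 1) / 2" and a = "(\<alpha> + 1) / 2" and b = \<beta>]
    show "(\<lambda>a. mittag_leffler a \<beta> t) field_differentiable at \<alpha>"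
      by (rule *(1)) (use assms lower in \<open>auto simp: mittag_leffler_def mult.commute\<close>)
    show "\<exists>F. laplace_continuation (\<lambda>t. deriv (\<lambda>a. mittag_leffler a \<beta> t) \<alpha>) F"
      by (rule *(2)) (use assms lower in \<open>auto simp: mittag_leffler_def mult.commute\<close>)
    show "summable (\<lambda>k. fact k * of_real (real k * Digamma_over_Gamma (real k * \<alpha> + \<beta>))
                      * s powi (- int k - 1)) \<and>
       laplace (\<lambda>t. deriv (\<lambda>a. mittag_leffler a \<beta> t) \<alpha>) s =
         - (\<Sum>k. fact k * of_real (real k * Digamma_over_Gamma (real k * \<alpha> + \<beta>))
                    * s powi (- int k - 1))" if "s \<noteq> 0"
      by (rule *(3)) (use assms lower that in \<open>auto simp: mittag_leffler_def mult.commute\<close>)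
  qed
  have beta: "(\<lambda>b. mittag_leffler \<alpha> b t) field_differentiable at \<beta>"
    "\<exists>F. laplace_continuation (\<lambda>t. deriv (\<lambda>b. mittag_leffler \<alpha> b t) \<beta>) F"
    "s \<noteq> 0 \<Longrightarrow>
       summable (\<lambda>k. fact k * of_real (1 * Digamma_over_Gamma (1 * \<beta> + \<alpha> * real k))
                      * s powi (- int k - 1)) \<and>
       laplace (\<lambda>t. deriv (\<lambda>b. mittag_leffler \<alpha> b t) \<beta>) s =
         - (\<Sum>k. fact k * of_real (1 * Digamma_over_Gamma (1 * \<beta> + \<alpha> * real k))
                    * s powi (- int k - 1))" for s t
  proof -
    note * = laplace_parameter_derivative[where f = "\<lambda>b t. mittag_leffler \<alpha> b t"
        and c = "\<lambda>_. 1" and d = "\<lambda>k. \<alpha> * real k" and p = \<beta> and \<delta> = 1 and a = \<alpha> and b = "\<beta> - 1"]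
    show "(\<lambda>b. mittag_leffler \<alpha> b t) field_differentiable at \<beta>"
      by (rule *(1)) (use assms in \<open>auto simp: mittag_leffler_def add.commute\<close>)
    show "\<exists>F. laplace_continuation (\<lambda>t. deriv (\<lambda>b. mittag_leffler \<alpha> b t) \<beta>) F"
      by (rule *(2)) (use assms in \<open>auto simp: mittag_leffler_def add.commute\<close>)
    show "summable (\<lambda>k. fact k * of_real (1 * Digamma_over_Gamma (1 * \<beta> + \<alpha> * real k))
                      * s powi (- int k - 1)) \<and>
       laplace (\<lambda>t. deriv (\<lambda>b. mittag_leffler \<alpha> b t) \<beta>) s =
         - (\<Sum>k. fact k * of_real (1 * Digamma_over_Gamma (1 * \<beta> + \<alpha> * real k))
                    * s powi (- int k - 1))" if "s \<noteq> 0"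
      by (rule *(3)) (use assms that in \<open>auto simp: mittag_leffler_def add.commute\<close>)
  qed
  have rearrange: "fact k * of_real (real k * Digamma_over_Gamma (real k * \<alpha> + \<beta>)) * z
                     = fact k * of_nat k * of_real (Digamma_over_Gamma (\<alpha> * real k + \<beta>)) * z"
                  "fact k * of_real (1 * Digamma_over_Gamma (1 * \<beta> + \<alpha> * real k)) * z
                     = fact k * of_real (Digamma_over_Gamma (\<alpha> * real k + \<beta>)) * z"
    for k and z :: complex
    by (simp_all add: mult_ac add.commute)
  show ?thesis
    using alpha beta unfolding rearrange by blast
qed

end
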